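(* Let $X,\mathcal{S}_X,u$ and the weak greedy sequences $\{u_m\},\{\widetilde w_m\},\{\gamma_m\},\{f_m\},\{\alpha_m\}$ be as in the context. Assume that $(1+\gamma_m)\alpha_m<1$ for all $m\ge1$, and let $\mu_m\ge 0$ be defined by $$\mu_m^2=\frac{1-(1+\gamma_m)^2\alpha_m^2}{1-\alpha_m^2}.$$ Assume further that the sequence $\{\mu_m\}_{m\ge1}$ is non-increasing and that $$\sum_{m=1}^\infty\frac{\mu_m^2}{m}=\infty.$$ Then the sequence $\{u_m\}_{m\ge1}$ converges to $u$ in $X$.
   Context: $X$ is a real Hilbert space (in the paper, a Hilbert tensor space) with norm $\|\cdot\|=\|\cdot\|_X$ and inner product $\langle\cdot,\cdot\rangle=\langle\cdot,\cdot\rangle_X$. $\mathcal{S}_X\subset X$ is a weakly closed subset with $\gamma\mathcal{S}_X\subset\mathcal{S}_X$ for all $\gamma\in\mathbb{R}$ and such that $\mathrm{span}(\mathcal{S}_X)$ is dense in $X$. Let $u\in X$. Weak greedy algorithm: $\{\gamma_m\}_{m\ge1}$ is a sequence of nonnegative parameters, $u_0=0$, and for $m\ge1$, $u_m=u_{m-1}+\widetilde w_m$, where $\widetilde w_m\in\mathcal{S}_X$ is any element satisfying $$\|u-u_{m-1}-\widetilde w_m\|\le(1+\gamma_m)\min_{w\in\mathcal{S}_X}\|u-u_{m-1}-w\|.$$ Put $f_m=u-u_m$ for $m\ge 0$; it is assumed that $f_{m}\neq0$ for all $m\ge0$. For $m\ge1$ let $w_m\in\arg\min_{w\in\mathcal{S}_X}\|f_{m-1}-w\|$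 be a best approximation of $f_{m-1}$ in $\mathcal{S}_X$, and $$\alpha_m=\frac{\|f_{m-1}-w_m\|}{\|f_{m-1}\|}\in[0,1).$$ *)

theory Defs
  imports "HOL-Analysis.Analysis"
begin

text \<open>The coarsest topology that makes every continuous linear functional continuous.\<close>

definition weak_topology :: "('a :: real_normed_vector) topology" where
  "weak_topology = topology_generated_by
     {\<phi> -` U | (\<phi> :: 'a \<Rightarrow> real) U. bounded_linear \<phi> \<and> open U}"

abbreviation weakly_closed :: "('a :: real_normed_vector) set \<Rightarrow> bool" where
  "weakly_closed S \<equiv> closedin weak_topology S"

lemma topspace_weak_topology [simp]: "topspace weak_topology = UNIV"
proof -
  have "UNIV = (\<lambda>_ :: 'a. 0 :: real) -` UNIV" by simp
  then have "(UNIV :: 'a set) \<in> {\<phi> -` U | (\<phi> :: 'a \<Rightarrow> real) U. bounded_linear \<phi> \<and> open U}"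
    using bounded_linear_zero open_UNIV by blast
  then show ?thesis
    unfolding weak_topology_def topology_generated_by_topspace by blast
qed

text \<open>
  A weak greedy run for \<open>u\<close> over the dictionary \<open>S\<close>: \<open>us\<close> are the iterates, \<open>wt m\<close> (for
  \<open>m \<ge> 1\<close>) the corrections.  The infimum is over a set bounded below by \<open>0\<close>, so it is the
  minimum whenever a best approximation exists (in particular for nonempty weakly closed \<open>S\<close>
  in a Hilbert space).  The values \<open>\<gamma> 0\<close> and \<open>wt 0\<close> play no role.
\<close>

definition weak_greedy ::
  "('a :: real_normed_vector) set \<Rightarrow> 'a \<Rightarrow> (nat \<Rightarrow> real) \<Rightarrow> (nat \<Rightarrow> 'a) \<Rightarrow> (nat \<Rightarrow> 'a) \<Rightarrow> bool"
where
  "weak_greedy S u \<gamma> us wt \<longleftrightarrow>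
     us 0 = 0 \<and>
     (\<forall>m\<ge>1. us m = us (m - 1) + wt m \<and> wt m \<in> S \<and>
        norm (u - us (m - 1) - wt m) \<le> (1 + \<gamma> m) * (INF w\<in>S. norm (u - us (m - 1) - w)))"

end

theory Submission
  imports Defs
begin

text \<open>
  Write \<open>\<sigma>\<^sub>m\<close> for the largest value of \<open>\<langle>f\<^sub>m\<^sub>-\<^sub>1, s\<rangle>\<close> over unit vectors \<open>s\<close> of the cone; by Pythagoras
  \<open>\<sigma>\<^sub>m\<^sup>2 = (1 - \<alpha>\<^sub>m\<^sup>2) \<parallel>f\<^sub>m\<^sub>-\<^sub>1\<parallel>\<^sup>2\<close>.  The parameter \<open>\<mu>\<^sub>m\<close> is chosen so that the greedy condition becomes
  \<open>\<parallel>f\<^sub>m\<parallel>\<^sup>2 \<le> \<parallel>f\<^sub>m\<^sub>-\<^sub>1\<parallel>\<^sup>2 - \<mu>\<^sub>m\<^sup>2 \<sigma>\<^sub>m\<^sup>2\<close>.  Telescoping shows that \<open>y\<^sub>m = \<mu>\<^sub>m \<sigma>\<^sub>m\<close> is square summable, and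
  the decrease of the residual norm alone bounds each correction by \<open>2 \<sigma>\<^sub>m\<close>.

  Since \<open>\<parallel>f\<^sub>n\<parallel>\<close> is non-increasing, it is enough to make it small for one \<open>n\<close>.  Split
  \<open>\<parallel>f\<^sub>n\<parallel>\<^sup>2 = \<langle>f\<^sub>n, u\<rangle> - \<langle>f\<^sub>n, u\<^sub>n\<rangle>\<close>.  As \<open>u\<close> is close to a fixed element of the span of the cone, the
  first term is small once \<open>\<sigma>\<^sub>n\<^sub>+\<^sub>1\<close> is; as \<open>u\<^sub>n\<close> is the sum of the corrections so far, the second is at
  most \<open>2 \<sigma>\<^sub>n\<^sub>+\<^sub>1 (\<sigma>\<^sub>1 + \<dots> + \<sigma>\<^sub>n)\<close>.  Both are controlled by \<open>\<sigma>\<^sub>m (\<sigma>\<^sub>1 + \<dots> + \<sigma>\<^sub>m)\<close> with \<open>m = n + 1\<close>, because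
  \<open>\<sigma>\<^sub>1 > 0\<close>.

  It remains to see that this last product comes arbitrarily close to \<open>0\<close>.  Monotonicity of \<open>\<mu>\<close>
  bounds it by \<open>y\<^sub>m (y\<^sub>1 + \<dots> + y\<^sub>m) / \<mu>\<^sub>m\<^sup>2\<close>.  By Hardy's inequality the averages of a square summable
  sequence are square summable, so \<open>\<Sum> y\<^sub>m (y\<^sub>1 + \<dots> + y\<^sub>m) / m\<close> converges; against
  \<open>\<Sum> \<mu>\<^sub>m\<^sup>2 / m = \<infinity>\<close> this leaves no room for a positive lower bound
  (\<open>square_summable_times_partial_sum_small\<close>).
\<close>

section \<open>Hardy's inequality and divergence\<close>

text \<open>
  Hardy's inequality with exponent \<open>2\<close>.  With \<open>A\<^sub>n\<close> the average of the first \<open>n\<close> terms,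
  \<open>y\<^sub>n = n A\<^sub>n - (n - 1) A\<^sub>n\<^sub>-\<^sub>1\<close> gives \<open>A\<^sub>n\<^sup>2 - 2 A\<^sub>n y\<^sub>n \<le> (n - 1) A\<^sub>n\<^sub>-\<^sub>1\<^sup>2 - n A\<^sub>n\<^sup>2\<close>, which telescopes, and
  \<open>2 A\<^sub>n y\<^sub>n \<le> A\<^sub>n\<^sup>2 / 2 + 2 y\<^sub>n\<^sup>2\<close>.  The boundary term \<open>N A\<^sub>N\<^sup>2\<close> is kept for the induction.
\<close>

lemma hardy_inequality_telescoped:
  fixes y :: "nat \<Rightarrow> real"
  defines "A \<equiv> \<lambda>n. (\<Sum>k=1..n. y k) / real n"
  shows "(\<Sum>n=1..N. (A n)\<^sup>2) + 2 * real N * (A N)\<^sup>2 \<le> 4 * (\<Sum>n=1..N. (y n)\<^sup>2)"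
proof (induction N)
  case 0
  show ?case by simp
next
  case (Suc N)
  define a b where "a = A N" and "b = A (Suc N)"
  have "real N * a = (\<Sum>k=1..N. y k)"
    by (cases "N = 0") (auto simp: a_def A_def)
  moreover have "real (Suc N) * b = (\<Sum>k=1..N. y k) + y (Suc N)"
    unfolding b_def A_def by (simp del: of_nat_Suc)
  ultimately have y: "y (Suc N) = real (Suc N) * b - real N * a" by simp
  \<comment> \<open>Twice the telescoping estimate; the first square is the slack in \<open>2 A y \<le> A\<^sup>2 / 2 + 2 y\<^sup>2\<close>.\<close>
  have "b\<^sup>2 + 2 * real (Suc N) * b\<^sup>2 - 2 * real N * a\<^sup>2 - 4 * (y (Suc N))\<^sup>2
      = - ((b - 2 * y (Suc N))\<^sup>2) - 2 * real N * (b - a)\<^sup>2"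
    unfolding y by (simp add: power2_eq_square algebra_simps)
  also have "\<dots> \<le> 0"
    using zero_le_power2[of "b - 2 * y (Suc N)"] mult_nonneg_nonneg[of "2 * real N" "(b - a)\<^sup>2", OF _ zero_le_power2]
    by linarith
  finally show ?case using Suc.IH
    unfolding a_def b_def by simp
qed

lemma hardy_inequality:
  fixes y :: "nat \<Rightarrow> real"
  shows "(\<Sum>n=1..N. ((\<Sum>k=1..n. y k) / real n)\<^sup>2) \<le> 4 * (\<Sum>n=1..N. (y n)\<^sup>2)"
proof -
  have "0 \<le> 2 * real N * ((\<Sum>k=1..N. y k) / real N)\<^sup>2" by simp
  then show ?thesis using hardy_inequality_telescoped[where y = y and N = N] by linarith
qed

text \<open>
  A lower bound \<open>\<epsilon> \<tau>\<^sub>n\<close> for all the products would, after division by \<open>n\<close> and summation, bound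
  \<open>\<Sum> \<tau>\<^sub>n / n\<close> by a multiple of \<open>\<Sum> y\<^sub>n\<^sup>2\<close> through Hardy's inequality.
\<close>

lemma square_summable_times_partial_sum_small:
  fixes y \<tau> :: "nat \<Rightarrow> real"
  assumes bounded: "\<And>N. (\<Sum>n=1..N. (y n)\<^sup>2) \<le> B"
    and diverges: "filterlim (\<lambda>N. \<Sum>n=1..N. \<tau> n / real n) at_top sequentially"
    and "\<epsilon> > 0"
  obtains n where "n \<ge> 1" "y n * (\<Sum>k=1..n. y k) < \<epsilon> * \<tau> n"
proof -
  have "\<exists>n\<ge>1. y n * (\<Sum>k=1..n. y k) < \<epsilon> * \<tau> n"
  proof (rule ccontr)
    assume "\<not> ?thesis"
    then have large: "\<epsilon> * \<tau> n \<le> y n * (\<Sum>k=1..n. y k)" if "n \<ge> 1" for n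
      using that by (meson not_less)
    define A where "A n = (\<Sum>k=1..n. y k) / real n" for n
    have "\<epsilon> * (\<Sum>n=1..N. \<tau> n / real n) \<le> 5 / 2 * B" for N
    proof -
      have "\<epsilon> * (\<tau> n / real n) \<le> ((y n)\<^sup>2 + (A n)\<^sup>2) / 2" if "n \<in> {1..N}" for n
      proof -
        have "\<epsilon> * (\<tau> n / real n) \<le> y n * A n"
          using large[of n] that by (simp add: A_def divide_right_mono)
        also have "\<dots> \<le> ((y n)\<^sup>2 + (A n)\<^sup>2) / 2"
          using sum_squares_bound[of "y n" "A n"] by simp
        finally show ?thesis .
      qed
      then have "\<epsilon> * (\<Sum>n=1..N. \<tau> n / real n) \<le> (\<Sum>n=1..N. ((y n)\<^sup>2 + (A n)\<^sup>2) / 2)"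
        unfolding sum_distrib_left by (rule sum_mono)
      also have "\<dots> = ((\<Sum>n=1..N. (y n)\<^sup>2) + (\<Sum>n=1..N. (A n)\<^sup>2)) / 2"
        by (simp add: sum.distrib flip: sum_divide_distrib)
      also have "\<dots> \<le> 5 / 2 * B"
        using bounded[of N] hardy_inequality[where y = y and N = N, folded A_def] by simp
      finally show ?thesis .
    qed
    then have "(\<Sum>n=1..N. \<tau> n / real n) \<le> 5 / 2 * B / \<epsilon>" for N
      using \<open>\<epsilon> > 0\<close> by (simp add: field_simps)
    moreover obtain N where "(\<Sum>n=1..N. \<tau> n / real n) \<ge> 5 / 2 * B / \<epsilon> + 1"
      using diverges unfolding filterlim_at_top eventually_sequentially by blast
    ultimately show False
      by (smt (verit))
  qed
  with that show ?thesis by blast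
qed

section \<open>Functionals on a cone and its span\<close>

text \<open>
  Scaling \<open>s\<close> to the orthogonal projection of \<open>f\<close> onto its line gives an element of the cone whose
  distance to \<open>f\<close> is explicit, and \<open>w\<close> is at least as close.
\<close>

lemma inner_le_best_approximation_gain:
  fixes f w s :: "'a :: real_inner"
  assumes cone: "\<And>c x. x \<in> S \<Longrightarrow> c *\<^sub>R x \<in> S"
    and best: "\<And>x. x \<in> S \<Longrightarrow> norm (f - w) \<le> norm (f - x)"
    and "s \<in> S"
  shows "\<bar>f \<bullet> s\<bar> \<le> sqrt ((norm f)\<^sup>2 - (norm (f - w))\<^sup>2) * norm s"
proof (cases "s = 0")
  case False
  define c where "c = (f \<bullet> s) / (norm s)\<^sup>2"
  have "(norm (f - w))\<^sup>2 \<le> (norm (f - c *\<^sub>R s))\<^sup>2"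
    using best[OF cone[OF \<open>s \<in> S\<close>]] by (intro power_mono) auto
  also have "\<dots> = (norm f)\<^sup>2 - 2 * c * (f \<bullet> s) + c\<^sup>2 * (norm s)\<^sup>2"
    unfolding power2_norm_eq_inner
    by (simp add: inner_diff inner_commute power2_eq_square algebra_simps)
  also have "\<dots> = (norm f)\<^sup>2 - (f \<bullet> s)\<^sup>2 / (norm s)\<^sup>2"
    using False by (simp add: c_def power2_eq_square field_simps)
  finally have "(f \<bullet> s)\<^sup>2 \<le> ((norm f)\<^sup>2 - (norm (f - w))\<^sup>2) * (norm s)\<^sup>2"
    using False by (simp add: field_simps)
  then have "sqrt ((f \<bullet> s)\<^sup>2) \<le> sqrt (((norm f)\<^sup>2 - (norm (f - w))\<^sup>2) * (norm s)\<^sup>2)"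
    by (rule real_sqrt_le_mono)
  then show ?thesis by (simp add: real_sqrt_mult)
qed simp

text \<open>
  The constant depends on the spanned vector only, so it can be fixed before the functional
  \<open>x \<bullet> _\<close> is made small on \<open>S\<close>.
\<close>

lemma inner_span_bound:
  fixes g :: "'a :: real_inner"
  assumes "g \<in> span S"
  obtains C where "C \<ge> 0"
    "\<And>x \<sigma>. (\<And>s. s \<in> S \<Longrightarrow> \<bar>x \<bullet> s\<bar> \<le> \<sigma> * norm s) \<Longrightarrow> \<bar>x \<bullet> g\<bar> \<le> C * \<sigma>"
proof -
  have "\<exists>C\<ge>0. \<forall>x \<sigma>. (\<forall>s\<in>S. \<bar>x \<bullet> s\<bar> \<le> \<sigma> * norm s) \<longrightarrow> \<bar>x \<bullet> g\<bar> \<le> C * \<sigma>"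
    using assms
  proof (induction rule: span_induct_alt)
    case base
    show ?case by (intro exI[of _ 0]) simp
  next
    case (step c s g)
    then obtain C where "C \<ge> 0" and C:
      "\<And>x \<sigma>. (\<forall>s\<in>S. \<bar>x \<bullet> s\<bar> \<le> \<sigma> * norm s) \<Longrightarrow> \<bar>x \<bullet> g\<bar> \<le> C * \<sigma>" by blast
    have "\<bar>x \<bullet> (c *\<^sub>R s + g)\<bar> \<le> (\<bar>c\<bar> * norm s + C) * \<sigma>"
      if *: "\<forall>s\<in>S. \<bar>x \<bullet> s\<bar> \<le> \<sigma> * norm s" for x \<sigma>
    proof -
      have "\<bar>x \<bullet> (c *\<^sub>R s + g)\<bar> \<le> \<bar>c\<bar> * \<bar>x \<bullet> s\<bar> + \<bar>x \<bullet> g\<bar>"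
        by (metis abs_mult abs_triangle_ineq inner_add_right inner_scaleR_right)
      also have "\<dots> \<le> \<bar>c\<bar> * (\<sigma> * norm s) + C * \<sigma>"
        using * step.hyps C[OF *] by (intro add_mono mult_left_mono) auto
      finally show ?thesis by (simp add: algebra_simps)
    qed
    then show ?case using \<open>C \<ge> 0\<close> by (intro exI[of _ "\<bar>c\<bar> * norm s + C"]) simp
  qed
  with that show ?thesis by blast
qed

section \<open>Convergence of the weak greedy iteration\<close>

theorem proposition6p5:
  fixes S :: "'a :: {real_inner, complete_space} set"
    and u :: 'a
    and us wt w f :: "nat \<Rightarrow> 'a"
    and \<gamma> \<alpha> \<mu> :: "nat \<Rightarrow> real"
  assumes S_closed: "weakly_closed S"
    and S_cone: "\<And>c x. x \<in> S \<Longrightarrow> c *\<^sub>R x \<in> S"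
    and S_dense: "closure (span S) = UNIV"
    and \<gamma>_nonneg: "\<And>m. m \<ge> 1 \<Longrightarrow> \<gamma> m \<ge> 0"
    and greedy: "weak_greedy S u \<gamma> us wt"
    and f: "\<And>m. f m = u - us m"
    and f_nonzero: "\<And>m. f m \<noteq> 0"
    and w: "\<And>m. m \<ge> 1 \<Longrightarrow> is_arg_min (\<lambda>x. norm (f (m - 1) - x)) (\<lambda>x. x \<in> S) (w m)"
    and \<alpha>: "\<And>m. m \<ge> 1 \<Longrightarrow> \<alpha> m = norm (f (m - 1) - w m) / norm (f (m - 1))"
    and \<alpha>_lt: "\<And>m. m \<ge> 1 \<Longrightarrow> (1 + \<gamma> m) * \<alpha> m < 1"
    and \<mu>_nonneg: "\<And>m. m \<ge> 1 \<Longrightarrow> \<mu> m \<ge> 0"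
    and \<mu>: "\<And>m. m \<ge> 1 \<Longrightarrow> (\<mu> m)\<^sup>2 = (1 - (1 + \<gamma> m)\<^sup>2 * (\<alpha> m)\<^sup>2) / (1 - (\<alpha> m)\<^sup>2)"
    and \<mu>_noninc: "\<And>m n. 1 \<le> m \<Longrightarrow> m \<le> n \<Longrightarrow> \<mu> n \<le> \<mu> m"
    and \<mu>_diverges: "filterlim (\<lambda>n. \<Sum>m=1..n. (\<mu> m)\<^sup>2 / real m) at_top sequentially"
  shows "us \<longlonglongrightarrow> u"
proof -
  define \<sigma> where "\<sigma> m = sqrt ((norm (f (m - 1)))\<^sup>2 - (norm (f (m - 1) - w m))\<^sup>2)" for m
  have best: "norm (f (m - 1) - w m) \<le> norm (f (m - 1) - x)" if "m \<ge> 1" "x \<in> S" for m x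
    using w[OF that(1)] that(2) unfolding is_arg_min_linorder by blast
  have dual: "\<bar>f (m - 1) \<bullet> s\<bar> \<le> \<sigma> m * norm s" if "m \<ge> 1" "s \<in> S" for m s
    unfolding \<sigma>_def using S_cone best[OF that(1)] that(2)
    by (rule inner_le_best_approximation_gain)
  have us: "us 0 = 0" "us m = us (m - 1) + wt m" "wt m \<in> S"
    and greedy_step: "norm (f m) \<le> (1 + \<gamma> m) * (INF x\<in>S. norm (f (m - 1) - x))"
    if "m \<ge> 1" for m
    using greedy that unfolding weak_greedy_def f by (auto simp: algebra_simps)
  have step: "f m = f (m - 1) - wt m" if "m \<ge> 1" for m
    using us(2)[OF that] by (simp add: f)

  have \<alpha>_range: "0 \<le> \<alpha> m" "\<alpha> m < 1" if "m \<ge> 1" for m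
  proof -
    show "0 \<le> \<alpha> m" using \<alpha>[OF that] by simp
    then have "0 \<le> \<gamma> m * \<alpha> m" using \<gamma>_nonneg[OF that] by simp
    then show "\<alpha> m < 1" using \<alpha>_lt[OF that] by (simp add: algebra_simps)
  qed
  have \<alpha>_sq: "(\<alpha> m)\<^sup>2 < 1" "((1 + \<gamma> m) * \<alpha> m)\<^sup>2 < 1" if "m \<ge> 1" for m
    using \<alpha>_range[OF that] \<alpha>_lt[OF that] \<gamma>_nonneg[OF that] by (simp_all add: power_less_one_iff abs_square_less_1)
  have dist_w: "norm (f (m - 1) - w m) = \<alpha> m * norm (f (m - 1))" if "m \<ge> 1" for m
    using \<alpha>[OF that] f_nonzero[of "m - 1"] by simp
  have \<sigma>_pos: "\<sigma> m > 0" and \<sigma>_sq: "(\<sigma> m)\<^sup>2 = (1 - (\<alpha> m)\<^sup>2) * (norm (f (m - 1)))\<^sup>2" if "m \<ge> 1" for m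
  proof -
    have "(norm (f (m - 1)))\<^sup>2 - (norm (f (m - 1) - w m))\<^sup>2
        = (1 - (\<alpha> m)\<^sup>2) * (norm (f (m - 1)))\<^sup>2"
      unfolding dist_w[OF that] by (simp add: power_mult_distrib algebra_simps)
    moreover have "\<dots> > 0" using \<alpha>_sq[OF that] f_nonzero[of "m - 1"] by simp
    ultimately show "\<sigma> m > 0" "(\<sigma> m)\<^sup>2 = (1 - (\<alpha> m)\<^sup>2) * (norm (f (m - 1)))\<^sup>2"
      by (simp_all add: \<sigma>_def)
  qed
  have \<mu>_pos: "\<mu> m > 0" if "m \<ge> 1" for m
  proof -
    have "(\<mu> m)\<^sup>2 > 0"
      unfolding \<mu>[OF that] using \<alpha>_sq[OF that] by (simp add: power_mult_distrib)
    then show ?thesis using \<mu>_nonneg[OF that] by (simp add: less_le)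
  qed

  have decrease: "(norm (f m))\<^sup>2 \<le> (norm (f (m - 1)))\<^sup>2 - (\<mu> m * \<sigma> m)\<^sup>2" if "m \<ge> 1" for m
  proof -
    have "w m \<in> S" using w[OF that] by (simp add: is_arg_min_linorder)
    then have "(INF x\<in>S. norm (f (m - 1) - x)) \<le> norm (f (m - 1) - w m)"
      by (intro cINF_lower bdd_belowI2[of _ 0]) auto
    then have "norm (f m) \<le> (1 + \<gamma> m) * (\<alpha> m * norm (f (m - 1)))"
      using greedy_step[OF that] \<gamma>_nonneg[OF that] dist_w[OF that]
      by (smt (verit) mult_left_mono)
    then have "(norm (f m))\<^sup>2 \<le> ((1 + \<gamma> m) * (\<alpha> m * norm (f (m - 1))))\<^sup>2"
      by (intro power_mono) auto
    also have "\<dots> = (norm (f (m - 1)))\<^sup>2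
        - (1 - (1 + \<gamma> m)\<^sup>2 * (\<alpha> m)\<^sup>2) * (norm (f (m - 1)))\<^sup>2"
      unfolding power_mult_distrib left_diff_distrib by simp
    also have "1 - (1 + \<gamma> m)\<^sup>2 * (\<alpha> m)\<^sup>2 = (\<mu> m)\<^sup>2 * (1 - (\<alpha> m)\<^sup>2)"
      using \<mu>[OF that] \<alpha>_sq[OF that] by simp
    finally show ?thesis using \<sigma>_sq[OF that] by (simp add: power_mult_distrib mult.assoc)
  qed
  have antimono: "norm (f n) \<le> norm (f m)" if "m \<le> n" for m n
  proof -
    have "norm (f (Suc k)) \<le> norm (f k)" for k
    proof (rule power2_le_imp_le)
      show "(norm (f (Suc k)))\<^sup>2 \<le> (norm (f k))\<^sup>2"
        using decrease[OF le_add1[of 1 k, unfolded plus_1_eq_Suc]]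
          zero_le_power2[of "\<mu> (Suc k) * \<sigma> (Suc k)"]
        unfolding diff_Suc_1 by linarith
    qed simp
    then show ?thesis using that by (rule lift_Suc_antimono_le)
  qed
  have square_summable: "(\<Sum>m=1..N. (\<mu> m * \<sigma> m)\<^sup>2) \<le> (norm u)\<^sup>2" for N
  proof -
    have "(\<Sum>m=1..N. (\<mu> m * \<sigma> m)\<^sup>2) \<le> (norm (f 0))\<^sup>2 - (norm (f N))\<^sup>2"
    proof (induction N)
      case (Suc N)
      then show ?case using decrease[of "Suc N"] by simp
    qed simp
    then show ?thesis using us(1)[OF order_refl] by (simp add: f) (smt (verit) zero_le_power2)
  qed
  \<comment> \<open>A correction longer than this would increase the residual norm.\<close>
  have correction: "norm (wt m) \<le> 2 * \<sigma> m" if "m \<ge> 1" for m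
  proof -
    have "(norm (f m))\<^sup>2 \<le> (norm (f (m - 1)))\<^sup>2"
      using antimono[of "m - 1" m] by (intro power_mono) auto
    moreover have "(norm (f m))\<^sup>2 = (norm (f (m - 1)))\<^sup>2 - 2 * (f (m - 1) \<bullet> wt m) + (norm (wt m))\<^sup>2"
      unfolding step[OF that]
      by (simp add: power2_norm_eq_inner inner_diff inner_commute algebra_simps)
    ultimately have "(norm (wt m))\<^sup>2 \<le> 2 * (\<sigma> m * norm (wt m))"
      using dual[OF that us(3)[OF that]] by linarith
    then show ?thesis
      using \<sigma>_pos[OF that] by (cases "wt m = 0") (simp_all add: power2_eq_square)
  qed

  have product_small: "\<exists>m\<ge>1. \<sigma> m * (\<Sum>k=1..m. \<sigma> k) < \<delta>" if "\<delta> > 0" for \<delta>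
  proof -
    obtain m where m: "m \<ge> 1"
      "\<mu> m * \<sigma> m * (\<Sum>k=1..m. \<mu> k * \<sigma> k) < \<delta> * (\<mu> m)\<^sup>2"
      using square_summable_times_partial_sum_small[OF square_summable \<mu>_diverges \<open>\<delta> > 0\<close>] .
    have "\<mu> m * (\<Sum>k=1..m. \<sigma> k) \<le> (\<Sum>k=1..m. \<mu> k * \<sigma> k)"
      unfolding sum_distrib_left using \<mu>_noninc \<sigma>_pos
      by (intro sum_mono mult_right_mono) (auto simp: less_imp_le)
    then have "\<mu> m * \<sigma> m * (\<mu> m * (\<Sum>k=1..m. \<sigma> k)) \<le> \<mu> m * \<sigma> m * (\<Sum>k=1..m. \<mu> k * \<sigma> k)"
      using \<mu>_pos[OF m(1)] \<sigma>_pos[OF m(1)] by (intro mult_left_mono) auto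
    with m(2) have "(\<mu> m)\<^sup>2 * (\<sigma> m * (\<Sum>k=1..m. \<sigma> k)) < (\<mu> m)\<^sup>2 * \<delta>"
      by (simp add: power2_eq_square mult_ac)
    then have "\<sigma> m * (\<Sum>k=1..m. \<sigma> k) < \<delta>"
      by (rule mult_left_less_imp_less) simp
    with m(1) show ?thesis by blast
  qed

  have residual_small: "\<exists>n. (norm (f n))\<^sup>2 \<le> \<epsilon>" if "\<epsilon> > 0" for \<epsilon>
  proof -
    \<comment> \<open>The three contributions below are at most \<open>\<eta>\<close>, \<open>norm u * \<eta>\<close> and \<open>\<eta>\<close>.\<close>
    define \<eta> where "\<eta> = \<epsilon> / (norm u + 2)"
    have denom: "norm u + 2 > 0" by (simp add: add_nonneg_pos)
    then have "\<eta> > 0" using that by (simp add: \<eta>_def)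
    obtain g where "g \<in> span S" and g: "norm (u - g) < \<eta>"
      using S_dense \<open>\<eta> > 0\<close> by (metis UNIV_I closure_approachable dist_commute dist_norm)
    obtain C where "C \<ge> 0" and
      C: "\<And>x \<sigma>. (\<And>s. s \<in> S \<Longrightarrow> \<bar>x \<bullet> s\<bar> \<le> \<sigma> * norm s) \<Longrightarrow> \<bar>x \<bullet> g\<bar> \<le> C * \<sigma>"
      using inner_span_bound[OF \<open>g \<in> span S\<close>] by metis
    \<comment> \<open>The second entry makes \<open>C * \<sigma> m\<close> small, since the partial sum is at least \<open>\<sigma> 1\<close>.\<close>
    define \<delta> where "\<delta> = min (\<eta> / 2) (\<eta> * \<sigma> 1 / (C + 1))"
    have "\<delta> > 0" using \<open>\<eta> > 0\<close> \<open>C \<ge> 0\<close> \<sigma>_pos[of 1] by (simp add: \<delta>_def)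
    then obtain m where "m \<ge> 1" and m: "\<sigma> m * (\<Sum>k=1..m. \<sigma> k) < \<delta>"
      using product_small by blast
    define x where "x = f (m - 1)"
    have "\<sigma> 1 \<le> (\<Sum>k=1..m. \<sigma> k)"
      using \<open>m \<ge> 1\<close> \<sigma>_pos by (intro member_le_sum) (auto simp: less_imp_le)
    then have "\<sigma> m * \<sigma> 1 \<le> \<sigma> m * (\<Sum>k=1..m. \<sigma> k)"
      using \<sigma>_pos[OF \<open>m \<ge> 1\<close>] by simp
    also have "\<dots> \<le> \<eta> / (C + 1) * \<sigma> 1" using m by (simp add: \<delta>_def)
    finally have "\<sigma> m \<le> \<eta> / (C + 1)"
      by (rule mult_right_le_imp_le) (simp add: \<sigma>_pos)
    then have "(C + 1) * \<sigma> m \<le> \<eta>" using \<open>C \<ge> 0\<close> by (simp add: field_simps)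
    then have "C * \<sigma> m \<le> \<eta>" using \<sigma>_pos[OF \<open>m \<ge> 1\<close>] by (simp add: algebra_simps)
    moreover have "\<bar>x \<bullet> g\<bar> \<le> C * \<sigma> m"
      unfolding x_def using dual[OF \<open>m \<ge> 1\<close>] by (rule C)
    ultimately have "x \<bullet> g \<le> \<eta>" by linarith
    moreover have "x \<bullet> (u - g) \<le> norm u * \<eta>"
    proof -
      have "norm x \<le> norm u"
        using antimono[of 0 "m - 1"] us(1)[OF order_refl] by (simp add: x_def f)
      then have "norm x * norm (u - g) \<le> norm u * \<eta>"
        using g by (intro mult_mono) auto
      then show ?thesis using norm_cauchy_schwarz[of x "u - g"] by linarith
    qed
    moreover have "- (x \<bullet> us (m - 1)) \<le> \<eta>"
    proof -
      have "us n = (\<Sum>k=1..n. wt k)" for n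
      proof (induction n)
        case 0
        show ?case using us(1)[OF order_refl] by simp
      next
        case (Suc n)
        then show ?case using us(2)[of "Suc n"] by simp
      qed
      then have "\<bar>x \<bullet> us (m - 1)\<bar> \<le> (\<Sum>k=1..m-1. \<bar>x \<bullet> wt k\<bar>)"
        by (simp add: inner_sum_right sum_abs)
      also have "\<dots> \<le> (\<Sum>k=1..m-1. 2 * (\<sigma> m * \<sigma> k))"
      proof (rule sum_mono)
        fix k assume k: "k \<in> {1..m-1}"
        have "\<bar>x \<bullet> wt k\<bar> \<le> \<sigma> m * norm (wt k)"
          unfolding x_def using k us(3) \<open>m \<ge> 1\<close> by (intro dual) auto
        also have "\<dots> \<le> \<sigma> m * (2 * \<sigma> k)"
          using k \<sigma>_pos[OF \<open>m \<ge> 1\<close>] by (intro mult_left_mono correction) auto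
        finally show "\<bar>x \<bullet> wt k\<bar> \<le> 2 * (\<sigma> m * \<sigma> k)" by simp
      qed
      also have "\<dots> \<le> (\<Sum>k=1..m. 2 * (\<sigma> m * \<sigma> k))"
        using \<sigma>_pos \<open>m \<ge> 1\<close> by (intro sum_mono2) (auto simp: less_imp_le)
      also have "\<dots> = 2 * (\<sigma> m * (\<Sum>k=1..m. \<sigma> k))"
        by (simp add: sum_distrib_left)
      also have "\<dots> \<le> \<eta>" using m by (simp add: \<delta>_def)
      finally show ?thesis by linarith
    qed
    moreover have "(norm x)\<^sup>2 = x \<bullet> g + x \<bullet> (u - g) - x \<bullet> us (m - 1)"
    proof -
      have "(norm x)\<^sup>2 = x \<bullet> (u - us (m - 1))" by (simp add: power2_norm_eq_inner x_def f)
      then show ?thesis by (simp add: inner_diff_right)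
    qed
    ultimately have "(norm x)\<^sup>2 \<le> (norm u + 2) * \<eta>" by (simp add: algebra_simps)
    also have "\<dots> = \<epsilon>" using denom by (simp add: \<eta>_def)
    finally show ?thesis unfolding x_def by blast
  qed

  show ?thesis
  proof (rule LIMSEQ_I)
    fix r :: real assume "r > 0"
    then obtain N where "(norm (f N))\<^sup>2 \<le> (r / 2)\<^sup>2"
      using residual_small[of "(r / 2)\<^sup>2"] by auto
    then have "norm (f N) \<le> r / 2"
      using \<open>r > 0\<close> by (auto intro: power2_le_imp_le)
    then have "norm (us n - u) < r" if "n \<ge> N" for n
      using antimono[OF that] \<open>r > 0\<close> unfolding f by (simp add: norm_minus_commute)
    then show "\<exists>N. \<forall>n\<ge>N. norm (us n - u) < r" by blast
  qed
qed

end
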